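(* Let $G=M\circ_Z N$. Set $I:=O(\Omega_M)$ and $J:=O(\Omega_N)$. For each $i\in I$ and $j\in J$ let $M_i$ and $N_j$ be the stabilizers of the orbits $i$ and $j$. Set $\mathcal{M}:=\{M_i\}_{i\in I}$ and $\mathcal{N}:=\{N_j\}_{j\in J}$. Assume that $\mathcal{A}:=\{A_i\}_{i\in I}$ and $\mathcal{B}:=\{B_j\}_{j\in J}$ is an $\mathcal{M}\mathcal{N}$-direct factorization system of $Z$. For each $i\in I$ and $j\in J$ fix conjugacy classes $C_i$ and $D_j$ belonging to the orbits $i$ and $j$ respectively. Then $G=X\times Y$ is a set-direct decomposition of $G$, where $$X:=\bigcup_{i\in I}A_iC_i\quad\text{and}\quad Y:=\bigcup_{j\in J}B_jD_j.$$
   Context: Groups may be infinite. A subset of a group $G$ is normal if it is invariant under conjugation by all elements of $G$. Set-direct product: for a group $G$ and non-empty subsets $X,Y\subseteq G$, the setwise product $XY$ is called direct, and is then written $X\times Y$, if both $X$ and $Y$ are normal in $G$ and every $g\in XY$ has a unique representation $g=xy$ with $x\in X$, $y\in Y$. A set-direct decomposition of $G$ is an equality $G=X\times Y$. Central product: $G=M\circ_Z N$ means that $M,N$ are subgroups of $G$ with $G=MN$, $M$ and $N$ centralize each other, and $Z=M\cap N$ (then $M,N$ are normal and $Z$ is central in $G$). Multiplication action: for $K\trianglelefteq G$ containing $Z$, $\Omega_K$ is the set of all conjugacy classes of $G$ contained in $K$; $Z$ acts on $\Omega_K$ by multiplication, $(z,C)\mapsto zC$. $O(\Omega_K)$ is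 the set of all orbits of this action. All conjugacy classes in one orbit have the same stabilizer in $Z$, and the stabilizer of an orbit means this common stabilizer (a subgroup of $Z$). Kernel: for an abelian group $H$ and $S\subseteq H$, $K_H(S):=\{h\in H: hS=S\}$, a subgroup of $H$. Direct factorization system: let $Z$ be an abelian group and let $\mathcal{M}=\{M_i\}_{i\in I}$ and $\mathcal{N}=\{N_j\}_{j\in J}$ be two multisets (indexed families, repetitions allowed) of subgroups of $Z$. An $\mathcal{M}\mathcal{N}$-direct factorization system of $Z$ is a pair of multisets $\{A_i\}_{i\in I}$, $\{B_j\}_{j\in J}$ of subsets of $Z$ such that for all $i\in I$, $j\in J$: $Z=A_i\times B_j$, $M_i\le K_Z(A_i)$, and $N_j\le K_Z(B_j)$. *)

theory Defs
  imports "HOL-Algebra.Group_Action"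
begin

text \<open>Set-direct products. The notation \<open>G = X \<times> Y\<close> of the literature is
  \<open>set_direct_decomposition G X Y\<close>.\<close>

definition normal_subset :: "('a, 'b) monoid_scheme \<Rightarrow> 'a set \<Rightarrow> bool" where
  "normal_subset G S \<longleftrightarrow>
     S \<subseteq> carrier G \<and> (\<forall>g\<in>carrier G. g <#\<^bsub>G\<^esub> S #>\<^bsub>G\<^esub> inv\<^bsub>G\<^esub> g = S)"

definition set_direct :: "('a, 'b) monoid_scheme \<Rightarrow> 'a set \<Rightarrow> 'a set \<Rightarrow> bool" where
  "set_direct G X Y \<longleftrightarrow>
     X \<noteq> {} \<and> Y \<noteq> {} \<and> normal_subset G X \<and> normal_subset G Y \<and>
     (\<forall>g \<in> X <#>\<^bsub>G\<^esub> Y. \<exists>!p. p \<in> X \<times> Y \<and> g = fst p \<otimes>\<^bsub>G\<^esub> snd p)"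

definition set_direct_decomposition ::
    "('a, 'b) monoid_scheme \<Rightarrow> 'a set \<Rightarrow> 'a set \<Rightarrow> bool" where
  "set_direct_decomposition G X Y \<longleftrightarrow> set_direct G X Y \<and> carrier G = X <#>\<^bsub>G\<^esub> Y"

definition central_product ::
    "('a, 'b) monoid_scheme \<Rightarrow> 'a set \<Rightarrow> 'a set \<Rightarrow> 'a set \<Rightarrow> bool" where
  "central_product G M N Z \<longleftrightarrow>
     group G \<and> subgroup M G \<and> subgroup N G \<and> carrier G = M <#>\<^bsub>G\<^esub> N \<and>
     (\<forall>m\<in>M. \<forall>n\<in>N. m \<otimes>\<^bsub>G\<^esub> n = n \<otimes>\<^bsub>G\<^esub> m) \<and> Z = M \<inter> N"

definition conjugacy_classes :: "('a, 'b) monoid_scheme \<Rightarrow> 'a set set" where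
  "conjugacy_classes G =
     orbits G (carrier G) (\<lambda>g. \<lambda>h\<in>carrier G. g \<otimes>\<^bsub>G\<^esub> h \<otimes>\<^bsub>G\<^esub> inv\<^bsub>G\<^esub> g)"

text \<open>The set \<open>\<Omega>\<^sub>K\<close>. The classes are those of the whole group \<open>G\<close>, not of \<open>K\<close>.\<close>

definition classes_in :: "('a, 'b) monoid_scheme \<Rightarrow> 'a set \<Rightarrow> 'a set set" where
  "classes_in G K = {C \<in> conjugacy_classes G. C \<subseteq> K}"

definition mult_action ::
    "('a, 'b) monoid_scheme \<Rightarrow> 'a set \<Rightarrow> 'a \<Rightarrow> 'a set \<Rightarrow> 'a set" where
  "mult_action G K = (\<lambda>z. \<lambda>C\<in>classes_in G K. z <#\<^bsub>G\<^esub> C)"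

definition mult_orbits ::
    "('a, 'b) monoid_scheme \<Rightarrow> 'a set \<Rightarrow> 'a set \<Rightarrow> 'a set set set" where
  "mult_orbits G Z K = orbits (G\<lparr>carrier := Z\<rparr>) (classes_in G K) (mult_action G K)"

text \<open>The common stabilizer of the members of an orbit; existence and uniqueness in the
  relevant situation are shown in \<open>orbit_stabilizer_eq\<close> below.\<close>

definition orbit_stabilizer ::
    "('a, 'b) monoid_scheme \<Rightarrow> 'a set \<Rightarrow> 'a set \<Rightarrow> 'a set set \<Rightarrow> 'a set" where
  "orbit_stabilizer G Z K i =
     (THE S. \<forall>C\<in>i. stabilizer (G\<lparr>carrier := Z\<rparr>) (mult_action G K) C = S)"

definition set_kernel :: "('a, 'b) monoid_scheme \<Rightarrow> 'a set \<Rightarrow> 'a set" where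
  "set_kernel H S = {h \<in> carrier H. h <#\<^bsub>H\<^esub> S = S}"

text \<open>Multisets of subsets are rendered as families over explicit index sets \<open>I\<close> and \<open>J\<close>;
  values of the families outside \<open>I\<close> and \<open>J\<close> are irrelevant.\<close>

definition direct_factorization_system ::
    "('a, 'b) monoid_scheme \<Rightarrow> 'i set \<Rightarrow> ('i \<Rightarrow> 'a set) \<Rightarrow> 'j set \<Rightarrow> ('j \<Rightarrow> 'a set) \<Rightarrow>
     ('i \<Rightarrow> 'a set) \<Rightarrow> ('j \<Rightarrow> 'a set) \<Rightarrow> bool" where
  "direct_factorization_system Z I M J N A B \<longleftrightarrow>
     comm_group Z \<and> (\<forall>i\<in>I. subgroup (M i) Z) \<and> (\<forall>j\<in>J. subgroup (N j) Z) \<and>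
     (\<forall>i\<in>I. A i \<subseteq> carrier Z) \<and> (\<forall>j\<in>J. B j \<subseteq> carrier Z) \<and>
     (\<forall>i\<in>I. \<forall>j\<in>J. set_direct_decomposition Z (A i) (B j) \<and>
        M i \<subseteq> set_kernel Z (A i) \<and> N j \<subseteq> set_kernel Z (B j))"


text \<open>The remaining lemmas justify the definitions: in a central product the multiplication
  action is a group action, the stabilizer of an orbit is well defined and a subgroup, and so
  the conditions on \<open>Z\<close>, \<open>M\<close> and \<open>N\<close> in a direct factorization system hold automatically.\<close>

lemma central_product_swap:
  assumes "central_product G M N Z"
  shows "central_product G N M Z"
proof -
  have "M <#>\<^bsub>G\<^esub> N = N <#>\<^bsub>G\<^esub> M"
    using assms unfolding central_product_def set_mult_def by fastforce
  then show ?thesis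
    using assms unfolding central_product_def by auto
qed

lemma central_product_central:
  assumes "central_product G M N Z" "z \<in> Z" "g \<in> carrier G"
  shows "z \<otimes>\<^bsub>G\<^esub> g = g \<otimes>\<^bsub>G\<^esub> z"
proof -
  interpret group G using assms unfolding central_product_def by auto
  have z: "z \<in> M" "z \<in> N" and sub: "M \<subseteq> carrier G" "N \<subseteq> carrier G"
    and comm: "\<And>m n. m \<in> M \<Longrightarrow> n \<in> N \<Longrightarrow> m \<otimes>\<^bsub>G\<^esub> n = n \<otimes>\<^bsub>G\<^esub> m"
    using assms by (auto simp: central_product_def subgroup.subset dest: subgroup.subset)
  obtain m n where g: "m \<in> M" "n \<in> N" "g = m \<otimes>\<^bsub>G\<^esub> n"
    using assms unfolding central_product_def set_mult_def by auto
  have mem: "z \<in> carrier G" "m \<in> carrier G" "n \<in> carrier G" using g z sub by auto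
  have "z \<otimes>\<^bsub>G\<^esub> (m \<otimes>\<^bsub>G\<^esub> n) = (m \<otimes>\<^bsub>G\<^esub> z) \<otimes>\<^bsub>G\<^esub> n"
    using comm[OF g(1) z(2)] mem by (simp add: m_assoc[symmetric])
  also have "\<dots> = (m \<otimes>\<^bsub>G\<^esub> n) \<otimes>\<^bsub>G\<^esub> z"
    using comm[OF z(1) g(2)] mem by (simp add: m_assoc)
  finally show ?thesis using g by simp
qed

lemma central_product_subgroup:
  assumes "central_product G M N Z"
  shows "subgroup Z G"
proof -
  interpret group G using assms unfolding central_product_def by auto
  show ?thesis
    using assms unfolding central_product_def by (metis subgroups_Inter_pair)
qed

lemma central_product_comm_group:
  assumes "central_product G M N Z"
  shows "comm_group (G\<lparr>carrier := Z\<rparr>)"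
proof -
  interpret group G using assms unfolding central_product_def by auto
  have Z: "subgroup Z G" using assms by (rule central_product_subgroup)
  show ?thesis
  proof (rule group.group_comm_groupI)
    show "group (G\<lparr>carrier := Z\<rparr>)" using Z subgroup_imp_group by blast
  qed (use central_product_central[OF assms] subgroup.subset[OF Z] in auto)
qed

lemma l_coset_conjugacy_class:
  assumes "central_product G M N Z" "z \<in> Z" "C \<in> conjugacy_classes G"
  shows "z <#\<^bsub>G\<^esub> C \<in> conjugacy_classes G"
proof -
  interpret group G using assms unfolding central_product_def by auto
  have zG: "z \<in> carrier G"
    using central_product_subgroup[OF assms(1)] assms(2) subgroup.mem_carrier by fast
  obtain x where x: "x \<in> carrier G" "C = {g \<otimes>\<^bsub>G\<^esub> x \<otimes>\<^bsub>G\<^esub> inv\<^bsub>G\<^esub> g | g. g \<in> carrier G}"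
    using assms(3) unfolding conjugacy_classes_def orbits_def orbit_def by auto
  have eq: "z \<otimes>\<^bsub>G\<^esub> (g \<otimes>\<^bsub>G\<^esub> x \<otimes>\<^bsub>G\<^esub> inv\<^bsub>G\<^esub> g) = g \<otimes>\<^bsub>G\<^esub> (z \<otimes>\<^bsub>G\<^esub> x) \<otimes>\<^bsub>G\<^esub> inv\<^bsub>G\<^esub> g"
    if "g \<in> carrier G" for g
  proof -
    have "z \<otimes>\<^bsub>G\<^esub> (g \<otimes>\<^bsub>G\<^esub> x \<otimes>\<^bsub>G\<^esub> inv\<^bsub>G\<^esub> g) = (z \<otimes>\<^bsub>G\<^esub> g) \<otimes>\<^bsub>G\<^esub> x \<otimes>\<^bsub>G\<^esub> inv\<^bsub>G\<^esub> g"
      using that x zG by (simp add: m_assoc)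
    also have "\<dots> = (g \<otimes>\<^bsub>G\<^esub> z) \<otimes>\<^bsub>G\<^esub> x \<otimes>\<^bsub>G\<^esub> inv\<^bsub>G\<^esub> g"
      using central_product_central[OF assms(1,2) that] by simp
    finally show ?thesis using that x zG by (simp add: m_assoc)
  qed
  have "z <#\<^bsub>G\<^esub> C = {g \<otimes>\<^bsub>G\<^esub> (z \<otimes>\<^bsub>G\<^esub> x) \<otimes>\<^bsub>G\<^esub> inv\<^bsub>G\<^esub> g | g. g \<in> carrier G}"
    unfolding x(2) l_coset_def using eq by force
  also have "\<dots> = orbit G (\<lambda>g. \<lambda>h\<in>carrier G. g \<otimes>\<^bsub>G\<^esub> h \<otimes>\<^bsub>G\<^esub> inv\<^bsub>G\<^esub> g) (z \<otimes>\<^bsub>G\<^esub> x)"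
    unfolding orbit_def using x zG by auto
  finally show ?thesis
    using x zG unfolding conjugacy_classes_def orbits_def by blast
qed

lemma conjugacy_class_subset:
  assumes "group G" "C \<in> conjugacy_classes G"
  shows "C \<subseteq> carrier G"
proof -
  interpret group G by fact
  show ?thesis using assms(2) unfolding conjugacy_classes_def orbits_def orbit_def by auto
qed

lemma group_action_mult_action:
  assumes cp: "central_product G M N Z"
  shows "group_action (G\<lparr>carrier := Z\<rparr>) (classes_in G M) (mult_action G M)"
proof -
  interpret group G using cp unfolding central_product_def by auto
  let ?E = "classes_in G M" and ?f = "mult_action G M"
  have Z: "subgroup Z G" using cp by (rule central_product_subgroup)
  have ZG: "Z \<subseteq> carrier G" using Z subgroup.subset by blast
  have sub: "C \<subseteq> carrier G" if "C \<in> ?E" for C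
    using that conjugacy_class_subset unfolding classes_in_def by blast
  have cl: "z <#\<^bsub>G\<^esub> C \<in> ?E" if "z \<in> Z" "C \<in> ?E" for z C
  proof -
    have "subgroup M G" "z \<in> M" "C \<subseteq> M"
      using cp that unfolding central_product_def classes_in_def by auto
    then have "z <#\<^bsub>G\<^esub> C \<subseteq> M" unfolding l_coset_def by (auto intro: subgroup.m_closed)
    then show ?thesis
      using l_coset_conjugacy_class[OF cp that(1)] that(2) unfolding classes_in_def by auto
  qed
  have assoc: "w <#\<^bsub>G\<^esub> (z <#\<^bsub>G\<^esub> C) = (w \<otimes>\<^bsub>G\<^esub> z) <#\<^bsub>G\<^esub> C" if "w \<in> Z" "z \<in> Z" "C \<in> ?E" for w z C
    using lcos_m_assoc[of C w z] sub[OF that(3)] ZG that by auto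
  have bij: "?f z \<in> Bij ?E" if z: "z \<in> Z" for z
  proof -
    have iz: "inv\<^bsub>G\<^esub> z \<in> Z" using Z z by (rule subgroup.m_inv_closed)
    have "bij_betw (\<lambda>C. z <#\<^bsub>G\<^esub> C) ?E ?E"
    proof (rule bij_betw_byWitness[where f' = "\<lambda>C. inv\<^bsub>G\<^esub> z <#\<^bsub>G\<^esub> C"])
      show "\<forall>C\<in>?E. inv\<^bsub>G\<^esub> z <#\<^bsub>G\<^esub> (z <#\<^bsub>G\<^esub> C) = C"
        using assoc[OF iz z] sub z ZG by (auto simp: lcos_mult_one)
      show "\<forall>C\<in>?E. z <#\<^bsub>G\<^esub> (inv\<^bsub>G\<^esub> z <#\<^bsub>G\<^esub> C) = C"
        using assoc[OF z iz] sub z ZG by (auto simp: lcos_mult_one)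
    qed (use cl z iz in auto)
    then show ?thesis unfolding Bij_def mult_action_def
      by (simp add: bij_betw_restrict_eq)
  qed
  have "?f \<in> hom (G\<lparr>carrier := Z\<rparr>) (BijGroup ?E)"
  proof (rule homI)
    fix w z assume "w \<in> carrier (G\<lparr>carrier := Z\<rparr>)" "z \<in> carrier (G\<lparr>carrier := Z\<rparr>)"
    then have wz: "w \<in> Z" "z \<in> Z" by auto
    have "?f (w \<otimes>\<^bsub>G\<^esub> z) = compose ?E (?f w) (?f z)"
      using assoc[OF wz] cl[OF wz(2)] unfolding mult_action_def compose_def by (auto intro!: restrict_ext)
    then show "?f (w \<otimes>\<^bsub>G\<lparr>carrier := Z\<rparr>\<^esub> z) = ?f w \<otimes>\<^bsub>BijGroup ?E\<^esub> ?f z"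
      using bij wz by (simp add: BijGroup_def)
  qed (use bij in \<open>auto simp: BijGroup_def\<close>)
  then show ?thesis
    unfolding group_action_def group_hom_def group_hom_axioms_def
    using subgroup_imp_group[OF Z] group_BijGroup by blast
qed

lemma orbit_stabilizer_eq:
  assumes cp: "central_product G M N Z" and i: "i \<in> mult_orbits G Z M" and C: "C \<in> i"
  shows "orbit_stabilizer G Z M i = stabilizer (G\<lparr>carrier := Z\<rparr>) (mult_action G M) C"
proof -
  let ?Z = "G\<lparr>carrier := Z\<rparr>" and ?f = "mult_action G M"
  interpret A: group_action ?Z "classes_in G M" ?f
    using cp by (rule group_action_mult_action)
  interpret Z: comm_group ?Z using cp by (rule central_product_comm_group)
  obtain D where D: "D \<in> classes_in G M" "i = orbit ?Z ?f D"
    using i unfolding mult_orbits_def orbits_def by auto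
  have st: "stabilizer ?Z ?f E = stabilizer ?Z ?f D" if "E \<in> i" for E
  proof -
    have "\<exists>z. E = ?f z D \<and> z \<in> carrier ?Z"
      using that unfolding D(2) orbit_def mem_Collect_eq .
    then obtain z where z: "z \<in> carrier ?Z" "E = ?f z D" by (elim exE conjE)
    have E: "?f w E = E \<longleftrightarrow> ?f w D = D" if w: "w \<in> carrier ?Z" for w
    proof -
      have "?f w E = ?f z (?f w D)"
        using A.composition_rule[OF D(1) w z(1)] A.composition_rule[OF D(1) z(1) w]
          Z.m_comm[OF w z(1)] z(2) by simp
      then show ?thesis
        using inj_onD[OF A.inj_prop[OF z(1)]] A.element_image[OF w D(1)] D(1) z(2) by auto
    qed
    then show ?thesis unfolding stabilizer_def by auto
  qed
  show ?thesis
    unfolding orbit_stabilizer_def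
    by (rule the_equality) (use st C in auto)
qed

lemma subgroup_orbit_stabilizer:
  assumes cp: "central_product G M N Z" and i: "i \<in> mult_orbits G Z M"
  shows "subgroup (orbit_stabilizer G Z M i) (G\<lparr>carrier := Z\<rparr>)"
proof -
  interpret A: group_action "G\<lparr>carrier := Z\<rparr>" "classes_in G M" "mult_action G M"
    using cp by (rule group_action_mult_action)
  obtain D where D: "D \<in> classes_in G M" "i = orbit (G\<lparr>carrier := Z\<rparr>) (mult_action G M) D"
    using i unfolding mult_orbits_def orbits_def by auto
  then show ?thesis
    using orbit_stabilizer_eq[OF cp i] A.orbit_refl[OF D(1)] A.stabilizer_subgroup[OF D(1)] by simp
qed

end

theory Submission
  imports Defs
begin

text \<open>Every element of \<open>M\<close> is \<open>w c\<close> with \<open>w \<in> Z\<close> and \<open>c\<close> in one of the chosen classes, so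
  \<open>G = M N\<close> and \<open>Z = A\<^sub>i B\<^sub>j\<close> give \<open>G = X Y\<close>. If \<open>(a c) (b d) = (a' c') (b' d')\<close>, then
  \<open>a c = z (a' c')\<close> and \<open>b' d' = z (b d)\<close> with the same \<open>z \<in> M \<inter> N = Z\<close>. Hence both sides involve
  the same orbits \<open>i\<close> and \<open>j\<close>, and \<open>z a'\<close> differs from \<open>a\<close> by an element of \<open>M\<^sub>i \<le> K(A\<^sub>i)\<close>, so that
  \<open>z a' \<in> A\<^sub>i\<close>; likewise \<open>z b \<in> B\<^sub>j\<close>. Now \<open>(z a') b = a' (z b)\<close> forces \<open>z = 1\<close> by directness of
  \<open>A\<^sub>i \<times> B\<^sub>j\<close>.\<close>

section \<open>Conjugacy classes and normal subsets of a group\<close>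

context group
begin

lemma conjugacy_class_through:
  assumes "x \<in> carrier G"
  obtains C where "C \<in> conjugacy_classes G" "x \<in> C"
proof -
  have "x \<in> \<Union> (conjugacy_classes G)"
    unfolding conjugacy_classes_def
    using group_action.orbits_coverture[OF action_by_conjugation] assms by simp
  then show ?thesis using that by blast
qed

lemma conjugacy_class_eq:
  assumes "C \<in> conjugacy_classes G" "C' \<in> conjugacy_classes G" "x \<in> C" "x \<in> C'"
  shows "C = C'"
  using group_action.disjoint_union[OF action_by_conjugation] assms
  unfolding conjugacy_classes_def by blast

text \<open>A class is by definition the orbit of some element. The orbit of \<open>x\<close> itself
  is also a class and shares \<open>x\<close> with \<open>C\<close>, so it is \<open>C\<close>;
  hence any member may serve as base point.\<close>

lemma conjugacy_class_transitive:
  assumes "C \<in> conjugacy_classes G" "x \<in> C" "y \<in> C"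
  obtains g where "g \<in> carrier G" "y = g \<otimes> x \<otimes> inv g"
proof -
  have C: "C \<in> orbits G (carrier G) (\<lambda>g. \<lambda>h\<in>carrier G. g \<otimes> h \<otimes> inv g)"
    using assms(1) unfolding conjugacy_classes_def .
  have x: "x \<in> carrier G"
    using conjugacy_class_subset[OF is_group assms(1)] assms(2) by blast
  then have "x \<in> orbit G (\<lambda>g. \<lambda>h\<in>carrier G. g \<otimes> h \<otimes> inv g) x"
    by (rule group_action.orbit_refl[OF action_by_conjugation])
  moreover have "orbit G (\<lambda>g. \<lambda>h\<in>carrier G. g \<otimes> h \<otimes> inv g) x \<in> conjugacy_classes G"
    using x unfolding conjugacy_classes_def orbits_def by blast
  ultimately have "C = orbit G (\<lambda>g. \<lambda>h\<in>carrier G. g \<otimes> h \<otimes> inv g) x"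
    using conjugacy_class_eq assms by blast
  then show ?thesis using assms(3) x that unfolding orbit_def by auto
qed

lemma conjugacy_class_closed:
  assumes "C \<in> conjugacy_classes G" "x \<in> C" "g \<in> carrier G"
  shows "g \<otimes> x \<otimes> inv g \<in> C"
proof -
  obtain y where y: "y \<in> carrier G" "C = {h \<otimes> y \<otimes> inv h | h. h \<in> carrier G}"
    using assms(1) unfolding conjugacy_classes_def orbits_def orbit_def by auto
  obtain h where h: "h \<in> carrier G" "x = h \<otimes> y \<otimes> inv h" using assms(2) y by auto
  have "g \<otimes> x \<otimes> inv g = (g \<otimes> h) \<otimes> y \<otimes> inv (g \<otimes> h)"
    using h y assms(3) by (simp add: m_assoc inv_mult_group)
  then show ?thesis using y h assms(3) by blast
qed

lemma normal_subsetI: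
  assumes "S \<subseteq> carrier G"
    and "\<And>g x. g \<in> carrier G \<Longrightarrow> x \<in> S \<Longrightarrow> g \<otimes> x \<otimes> inv g \<in> S"
  shows "normal_subset G S"
  unfolding normal_subset_def
proof (intro conjI ballI assms(1) subset_antisym subsetI)
  fix g x assume g: "g \<in> carrier G"
  show "x \<in> g <# S #> inv g \<Longrightarrow> x \<in> S"
    using assms(2)[OF g] unfolding l_coset_def r_coset_def by auto
  assume x: "x \<in> S"
  \<comment> \<open>The reverse inclusion uses closure under conjugation by \<open>inv g\<close>.
    Left association cancels the pair in front of \<open>x\<close>, right association the pair
    behind it.\<close>
  then have "x = g \<otimes> (inv g \<otimes> x \<otimes> inv (inv g)) \<otimes> inv g"
    using g assms(1) by (simp add: m_assoc[symmetric] subset_iff)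
      (simp add: m_assoc subset_iff)
  moreover have "inv g \<otimes> x \<otimes> inv (inv g) \<in> S" using assms(2) g x by blast
  ultimately show "x \<in> g <# S #> inv g" unfolding l_coset_def r_coset_def by blast
qed

end

section \<open>Orbits of the multiplication action on one factor of a central product\<close>

context
  fixes G :: "('a, 'b) monoid_scheme" (structure) and M N Z :: "'a set"
  assumes cp: "central_product G M N Z"
begin

interpretation group G using cp unfolding central_product_def by auto

lemma mult_orbits_memD:
  assumes "i \<in> mult_orbits G Z M" "C \<in> i"
  shows "C \<in> conjugacy_classes G" "C \<subseteq> M" "C \<subseteq> carrier G" "C \<noteq> {}"
proof -
  interpret A: group_action "G\<lparr>carrier := Z\<rparr>" "classes_in G M" "mult_action G M"
    using cp by (rule group_action_mult_action)
  have "C \<in> classes_in G M"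
    using A.orbits_coverture assms unfolding mult_orbits_def by blast
  then show C: "C \<in> conjugacy_classes G" and "C \<subseteq> M" unfolding classes_in_def by auto
  show "C \<subseteq> carrier G" using conjugacy_class_subset[OF is_group C] .
  show "C \<noteq> {}" using C unfolding conjugacy_classes_def orbits_def orbit_def by auto
qed

text \<open>Orbits are disjoint, so \<open>i'\<close> is the orbit of any of its members, in
  particular of \<open>C'\<close>. This reduces comparing orbits to comparing
  representatives.\<close>

lemma mult_orbits_eq_iff:
  assumes "i \<in> mult_orbits G Z M" "i' \<in> mult_orbits G Z M" "C \<in> i" "C' \<in> i'"
  shows "i = i' \<longleftrightarrow> (\<exists>z\<in>Z. C = z <# C')"
proof -
  interpret A: group_action "G\<lparr>carrier := Z\<rparr>" "classes_in G M" "mult_action G M"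
    using cp by (rule group_action_mult_action)
  have C': "C' \<in> classes_in G M"
    using mult_orbits_memD[OF assms(2,4)] unfolding classes_in_def by auto
  let ?o = "orbit (G\<lparr>carrier := Z\<rparr>) (mult_action G M) C'"
  have "?o \<in> mult_orbits G Z M"
    using C' unfolding mult_orbits_def orbits_def by blast
  then have o: "i' = ?o"
    using A.disjoint_union assms(2,4) A.orbit_refl[OF C'] unfolding mult_orbits_def by blast
  have "i = i' \<longleftrightarrow> C \<in> i'"
    using A.disjoint_union assms unfolding mult_orbits_def by blast
  also have "\<dots> \<longleftrightarrow> (\<exists>z\<in>Z. C = z <# C')"
    unfolding o using C' by (auto simp: orbit_def mult_action_def)
  finally show ?thesis .
qed

text \<open>Since \<open>z\<close> is central, \<open>z <# C'\<close> is again a conjugacy class,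
  and two classes with a common element coincide.\<close>

lemma class_translate:
  assumes "i \<in> mult_orbits G Z M" "i' \<in> mult_orbits G Z M" "C \<in> i" "C' \<in> i'"
    and "c' \<in> C'" "z \<in> Z" "z \<otimes> c' \<in> C"
  shows "C = z <# C'"
proof (rule conjugacy_class_eq)
  show "C \<in> conjugacy_classes G" using mult_orbits_memD[OF assms(1,3)] by simp
  show "z <# C' \<in> conjugacy_classes G"
    using l_coset_conjugacy_class[OF cp \<open>z \<in> Z\<close>] mult_orbits_memD[OF assms(2,4)] by simp
  show "z \<otimes> c' \<in> z <# C'" using assms(5) unfolding l_coset_def by auto
qed fact

text \<open>By \<open>class_translate\<close> with both classes equal, a single element that
  \<open>z\<close> keeps inside \<open>C\<close> already forces \<open>z\<close> to fix
  \<open>C\<close>; the stabilizer of \<open>C\<close> is that of its orbit.\<close>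

lemma orbit_stabilizerI:
  assumes "i \<in> mult_orbits G Z M" "C \<in> i" "c \<in> C" "z \<in> Z" "z \<otimes> c \<in> C"
  shows "z \<in> orbit_stabilizer G Z M i"
proof -
  have "C = z <# C" using class_translate[OF assms(1,1,2,2,3-5)] .
  moreover have "C \<in> classes_in G M"
    using mult_orbits_memD[OF assms(1,2)] unfolding classes_in_def by auto
  ultimately show ?thesis
    unfolding orbit_stabilizer_eq[OF cp assms(1,2)] stabilizer_def mult_action_def
    using \<open>z \<in> Z\<close> by simp
qed

text \<open>The class of \<open>m\<close> lies in some orbit, hence is a translate by an element of
  \<open>Z\<close> of the class chosen in that orbit.\<close>

lemma mult_orbits_decompose:
  assumes C: "\<And>i. i \<in> mult_orbits G Z M \<Longrightarrow> C i \<in> i" and m: "m \<in> M"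
  obtains i w c where "i \<in> mult_orbits G Z M" "w \<in> Z" "c \<in> C i" "m = w \<otimes> c"
proof -
  interpret A: group_action "G\<lparr>carrier := Z\<rparr>" "classes_in G M" "mult_action G M"
    using cp by (rule group_action_mult_action)
  have M: "subgroup M G" and N: "subgroup N G"
    and comm: "\<And>m n. m \<in> M \<Longrightarrow> n \<in> N \<Longrightarrow> m \<otimes> n = n \<otimes> m"
    and MN: "carrier G = M <#> N"
    using cp unfolding central_product_def by auto
  have mG: "m \<in> carrier G" using m M subgroup.mem_carrier by fast
  obtain K where K: "K \<in> conjugacy_classes G" "m \<in> K" using conjugacy_class_through[OF mG] .
  \<comment> \<open>Membership in \<open>classes_in G M\<close> asks for the whole
    \<open>G\<close>-class to lie in \<open>M\<close>. A conjugator \<open>h \<otimes> n\<close>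
    with \<open>h\<close> in \<open>M\<close> and \<open>n\<close> in \<open>N\<close> acts on
    \<open>m\<close> as \<open>h\<close> alone, because \<open>n\<close> commutes with
    \<open>m\<close>.\<close>
  have "K \<subseteq> M"
  proof
    fix x assume "x \<in> K"
    then obtain g where g: "g \<in> carrier G" "x = g \<otimes> m \<otimes> inv g"
      using conjugacy_class_transitive K by metis
    obtain h n where h: "h \<in> M" "n \<in> N" "g = h \<otimes> n"
      using g(1) unfolding MN set_mult_def by auto
    have hG: "h \<in> carrier G" "n \<in> carrier G"
      using h M N subgroup.mem_carrier by fast+
    have "x = h \<otimes> (n \<otimes> m) \<otimes> inv n \<otimes> inv h"
      using g(2) h(3) hG mG by (simp add: inv_mult_group m_assoc)
    also have "n \<otimes> m = m \<otimes> n" using comm[OF m h(2)] by simp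
    also have "h \<otimes> (m \<otimes> n) \<otimes> inv n \<otimes> inv h = h \<otimes> m \<otimes> inv h"
      using hG mG by (simp add: m_assoc inv_solve_right)
    finally show "x \<in> M"
      using h(1) m M by (simp add: subgroup.m_closed subgroup.m_inv_closed)
  qed
  then have "K \<in> classes_in G M" using K unfolding classes_in_def by simp
  then obtain i where i: "i \<in> mult_orbits G Z M" "K \<in> i"
    using A.orbits_coverture unfolding mult_orbits_def by blast
  then obtain w where "w \<in> Z" "K = w <# C i"
    using mult_orbits_eq_iff[OF i(1) i(1) i(2) C[OF i(1)]] by auto
  then show ?thesis using K(2) i(1) that unfolding l_coset_def by auto
qed

text \<open>Decomposing \<open>\<one>\<close> along any choice of representatives exhibits an orbit.
  \<open>SOME\<close> supplies such a choice, every orbit being nonempty.\<close>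

lemma mult_orbits_nonempty: "mult_orbits G Z M \<noteq> {}"
proof -
  have one: "\<one> \<in> M" using cp unfolding central_product_def by (simp add: subgroup.one_closed)
  have "(SOME K. K \<in> i) \<in> i" if i: "i \<in> mult_orbits G Z M" for i
  proof -
    interpret A: group_action "G\<lparr>carrier := Z\<rparr>" "classes_in G M" "mult_action G M"
      using cp by (rule group_action_mult_action)
    have "i \<noteq> {}"
      using i A.orbit_refl unfolding mult_orbits_def orbits_def by blast
    then show ?thesis by (simp add: some_in_eq)
  qed
  then show ?thesis using mult_orbits_decompose[OF _ one] by blast
qed

text \<open>Conjugation passes over the central coefficient \<open>a\<close> and acts only on
  \<open>c\<close>, which stays in its class.\<close>

lemma normal_subset_Union_classes:
  assumes C: "\<And>i. i \<in> mult_orbits G Z M \<Longrightarrow> C i \<in> i"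
    and A: "\<And>i. i \<in> mult_orbits G Z M \<Longrightarrow> A i \<subseteq> Z"
  shows "normal_subset G (\<Union>i\<in>mult_orbits G Z M. A i <#> C i)"
proof (rule normal_subsetI)
  have ZG: "Z \<subseteq> carrier G" using central_product_subgroup[OF cp] by (rule subgroup.subset)
  then show "(\<Union>i\<in>mult_orbits G Z M. A i <#> C i) \<subseteq> carrier G"
    using A mult_orbits_memD(3)[OF _ C] by (intro UN_least set_mult_closed) auto
  fix g x assume g: "g \<in> carrier G" and "x \<in> (\<Union>i\<in>mult_orbits G Z M. A i <#> C i)"
  then obtain i a c where i: "i \<in> mult_orbits G Z M" and a: "a \<in> A i" and c: "c \<in> C i"
    and x: "x = a \<otimes> c" unfolding set_mult_def by auto
  have aZ: "a \<in> Z" using A i a by auto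
  have mem: "a \<in> carrier G" "c \<in> carrier G"
    using aZ ZG c mult_orbits_memD(3)[OF i C[OF i]] by auto
  have "g \<otimes> x \<otimes> inv g = (g \<otimes> a) \<otimes> c \<otimes> inv g" using x g mem by (simp add: m_assoc)
  also have "g \<otimes> a = a \<otimes> g" using central_product_central[OF cp aZ g] by simp
  also have "a \<otimes> g \<otimes> c \<otimes> inv g = a \<otimes> (g \<otimes> c \<otimes> inv g)" using g mem by (simp add: m_assoc)
  finally have "g \<otimes> x \<otimes> inv g = a \<otimes> (g \<otimes> c \<otimes> inv g)" .
  moreover have "g \<otimes> c \<otimes> inv g \<in> C i"
    using conjugacy_class_closed mult_orbits_memD(1)[OF i C[OF i]] c g by blast
  ultimately show "g \<otimes> x \<otimes> inv g \<in> (\<Union>i\<in>mult_orbits G Z M. A i <#> C i)"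
    using i a unfolding set_mult_def by auto
qed

text \<open>This is the comparison of two products that differ by a central \<open>z\<close>; it
  serves both factors of \<open>G\<close>. The premise \<open>C = C'\<close> is separate because one
  orbit may contain several classes; for representatives fixed per orbit it follows from
  \<open>i = i'\<close>.\<close>

lemma class_factor_translate:
  assumes i: "i \<in> mult_orbits G Z M" "C \<in> i" and i': "i' \<in> mult_orbits G Z M" "C' \<in> i'"
    and c: "c \<in> C" and c': "c' \<in> C'" and a: "a \<in> Z" and a': "a' \<in> Z" and z: "z \<in> Z"
    and eq: "a \<otimes> c = z \<otimes> (a' \<otimes> c')"
  shows "i = i'"
    and "\<lbrakk>C = C'; orbit_stabilizer G Z M i \<subseteq> set_kernel (G\<lparr>carrier := Z\<rparr>) S; a \<in> S\<rbrakk>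
      \<Longrightarrow> z \<otimes> a' \<in> S"
proof -
  have Z: "subgroup Z G" using central_product_subgroup[OF cp] .
  have mem: "a \<in> carrier G" "a' \<in> carrier G" "z \<in> carrier G" "c \<in> carrier G" "c' \<in> carrier G"
    using subgroup.subset[OF Z] a a' z c c' mult_orbits_memD(3)[OF i] mult_orbits_memD(3)[OF i'] by auto
  \<comment> \<open>This \<open>w\<close> satisfies both \<open>w \<otimes> c' = c\<close>, which
    relates the classes, and \<open>a \<otimes> w = z \<otimes> a'\<close>, which relates the
    coefficients.\<close>
  define w where "w = inv a \<otimes> (z \<otimes> a')"
  have w: "w \<in> Z" unfolding w_def using Z a a' z by (simp add: subgroup.m_closed subgroup.m_inv_closed)
  have "w \<otimes> c' = inv a \<otimes> (a \<otimes> c)" unfolding w_def eq using mem by (simp add: m_assoc)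
  then have wc: "w \<otimes> c' = c" using mem by (simp add: m_assoc[symmetric])
  then have "C = w <# C'" using class_translate[OF i(1) i'(1) i(2) i'(2) c' w] c by simp
  then show "i = i'" using mult_orbits_eq_iff[OF i(1) i'(1) i(2) i'(2)] w by blast
  assume "C = C'" "orbit_stabilizer G Z M i \<subseteq> set_kernel (G\<lparr>carrier := Z\<rparr>) S" "a \<in> S"
  moreover have "w \<in> orbit_stabilizer G Z M i"
    using orbit_stabilizerI[OF i _ w, of c'] c c' wc \<open>C = C'\<close> by simp
  ultimately have "w <# S = S" unfolding set_kernel_def l_coset_def by auto
  then have "w \<otimes> a \<in> S" using \<open>a \<in> S\<close> unfolding l_coset_def by auto
  also have "w \<otimes> a = a \<otimes> w" using central_product_central[OF cp w mem(1)] .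
  also have "a \<otimes> w = z \<otimes> a'" unfolding w_def using mem by (simp add: m_assoc[symmetric])
  finally show "z \<otimes> a' \<in> S" .
qed

end

section \<open>Covering and uniqueness for the product of the two unions\<close>

theorem theorem1p6:
  fixes G :: "('a, 'b) monoid_scheme" (structure)
    and M N Z :: "'a set"
    and I J :: "'a set set set"
    and A B C D :: "'a set set \<Rightarrow> 'a set"
  assumes "central_product G M N Z"
    and "I = mult_orbits G Z M"
    and "J = mult_orbits G Z N"
    and "direct_factorization_system (G\<lparr>carrier := Z\<rparr>)
           I (orbit_stabilizer G Z M) J (orbit_stabilizer G Z N) A B"
    and "\<And>i. i \<in> I \<Longrightarrow> C i \<in> i"
    and "\<And>j. j \<in> J \<Longrightarrow> D j \<in> j"
  shows "set_direct_decomposition G (\<Union>i\<in>I. A i <#> C i) (\<Union>j\<in>J. B j <#> D j)"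
proof -
  note cp = assms(1) and I = assms(2) and J = assms(3) and C = assms(5) and D = assms(6)
  interpret group G using cp unfolding central_product_def by auto
  \<comment> \<open>The orbit lemmas speak about the first factor; exchanging the factors makes them
    available for \<open>N\<close>.\<close>
  have cp': "central_product G N M Z" using cp by (rule central_product_swap)
  have Z: "subgroup Z G" using central_product_subgroup[OF cp] .
  have M: "subgroup M G" and N: "subgroup N G" and MN: "carrier G = M <#> N"
    and ZMN: "Z = M \<inter> N"
    using cp unfolding central_product_def by auto
  have ZG: "Z \<subseteq> carrier G" using subgroup.subset[OF Z] .
  have AZ: "A i \<subseteq> Z" if "i \<in> I" for i
    using assms(4) that unfolding direct_factorization_system_def by simp
  have BZ: "B j \<subseteq> Z" if "j \<in> J" for j
    using assms(4) that unfolding direct_factorization_system_def by simp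
  have dec: "set_direct_decomposition (G\<lparr>carrier := Z\<rparr>) (A i) (B j)"
    and kA: "orbit_stabilizer G Z M i \<subseteq> set_kernel (G\<lparr>carrier := Z\<rparr>) (A i)"
    and kB: "orbit_stabilizer G Z N j \<subseteq> set_kernel (G\<lparr>carrier := Z\<rparr>) (B j)"
    if "i \<in> I" "j \<in> J" for i j
    using assms(4) that unfolding direct_factorization_system_def by auto
  have ZAB: "Z = A i <#> B j" if "i \<in> I" "j \<in> J" for i j
    using dec[OF that] unfolding set_direct_decomposition_def set_mult_def by simp
  have uniq: "a = a'"
    if "i \<in> I" "j \<in> J" "a \<in> A i" "a' \<in> A i" "b \<in> B j" "b' \<in> B j" "a \<otimes> b = a' \<otimes> b'"
    for i j a a' b b'
  proof -
    have "\<exists>!p. p \<in> A i \<times> B j \<and> a \<otimes> b = fst p \<otimes> snd p"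
      using dec[OF that(1,2)] that(3,5)
      unfolding set_direct_decomposition_def set_direct_def set_mult_def by auto
    moreover have "(a, b) \<in> A i \<times> B j \<and> a \<otimes> b = fst (a, b) \<otimes> snd (a, b)"
      "(a', b') \<in> A i \<times> B j \<and> a \<otimes> b = fst (a', b') \<otimes> snd (a', b')"
      using that by auto
    ultimately have "(a, b) = (a', b')" by blast
    then show ?thesis by simp
  qed
  have CM: "C i \<subseteq> M" "C i \<noteq> {}" if "i \<in> I" for i
    using mult_orbits_memD(2,4)[OF cp that[unfolded I] C[OF that]] by auto
  have DN: "D j \<subseteq> N" "D j \<noteq> {}" if "j \<in> J" for j
    using mult_orbits_memD(2,4)[OF cp' that[unfolded J] D[OF that]] by auto
  have ne: "I \<noteq> {}" "J \<noteq> {}"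
    unfolding I J using mult_orbits_nonempty[OF cp] mult_orbits_nonempty[OF cp'] by auto
  let ?X = "\<Union>i\<in>I. A i <#> C i" and ?Y = "\<Union>j\<in>J. B j <#> D j"
  have nX: "normal_subset G ?X"
    using normal_subset_Union_classes[OF cp, of C A] C AZ unfolding I by simp
  have nY: "normal_subset G ?Y"
    using normal_subset_Union_classes[OF cp', of D B] D BZ unfolding J by simp
  have XY: "?X <#> ?Y \<subseteq> carrier G"
    using nX nY unfolding normal_subset_def by (intro set_mult_closed) simp_all
  have cover: "carrier G \<subseteq> ?X <#> ?Y"
  proof
    fix g assume "g \<in> carrier G"
    then obtain m n where m: "m \<in> M" and n: "n \<in> N" and g: "g = m \<otimes> n"
      unfolding MN set_mult_def by auto
    obtain i w c where i: "i \<in> I" and w: "w \<in> Z" and c: "c \<in> C i" and mw: "m = w \<otimes> c"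
      using mult_orbits_decompose[OF cp _ m, of C] C unfolding I by blast
    obtain j v d where j: "j \<in> J" and v: "v \<in> Z" and d: "d \<in> D j" and nv: "n = v \<otimes> d"
      using mult_orbits_decompose[OF cp' _ n, of D] D unfolding J by blast
    \<comment> \<open>Neither \<open>w\<close> nor \<open>v\<close> need lie in \<open>A i\<close>
      or \<open>B j\<close>. Their product is factored anew, and centrality lets the new
      coefficients be distributed to \<open>c\<close> and \<open>d\<close>.\<close>
    have "w \<otimes> v \<in> Z" using Z w v by (simp add: subgroup.m_closed)
    then obtain a b where a: "a \<in> A i" and b: "b \<in> B j" and ab: "w \<otimes> v = a \<otimes> b"
      unfolding ZAB[OF i j] set_mult_def by auto
    have mem: "w \<in> carrier G" "v \<in> carrier G" "a \<in> carrier G" "b \<in> carrier G"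
      "c \<in> carrier G" "d \<in> carrier G"
      using ZG w v a AZ[OF i] b BZ[OF j] c CM[OF i] d DN[OF j]
        subgroup.subset[OF M] subgroup.subset[OF N] by blast+
    have vc: "v \<otimes> c = c \<otimes> v" and bc: "b \<otimes> c = c \<otimes> b"
      using central_product_central[OF cp] v b BZ[OF j] mem by auto
    have "g = w \<otimes> (c \<otimes> v) \<otimes> d" using g mw nv mem by (simp add: m_assoc)
    also have "\<dots> = (w \<otimes> v) \<otimes> (c \<otimes> d)" using mem by (simp add: m_assoc vc[symmetric])
    also have "\<dots> = a \<otimes> (b \<otimes> c) \<otimes> d" using ab mem by (simp add: m_assoc)
    also have "\<dots> = (a \<otimes> c) \<otimes> (b \<otimes> d)" using mem by (simp add: m_assoc bc)
    finally show "g \<in> ?X <#> ?Y" using i j a b c d unfolding set_mult_def by blast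
  qed
  have inj: "x = x' \<and> y = y'"
    if x: "x \<in> ?X" and x': "x' \<in> ?X" and y: "y \<in> ?Y" and y': "y' \<in> ?Y" and eq: "x \<otimes> y = x' \<otimes> y'"
    for x x' y y'
  proof -
    obtain i a c where i: "i \<in> I" and a: "a \<in> A i" and c: "c \<in> C i" and xac: "x = a \<otimes> c"
      using x unfolding set_mult_def by auto
    obtain i' a' c' where i': "i' \<in> I" and a': "a' \<in> A i'" and c': "c' \<in> C i'"
      and xac': "x' = a' \<otimes> c'"
      using x' unfolding set_mult_def by auto
    obtain j b d where j: "j \<in> J" and b: "b \<in> B j" and d: "d \<in> D j" and ybd: "y = b \<otimes> d"
      using y unfolding set_mult_def by auto
    obtain j' b' d' where j': "j' \<in> J" and b': "b' \<in> B j'" and d': "d' \<in> D j'"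
      and ybd': "y' = b' \<otimes> d'"
      using y' unfolding set_mult_def by auto
    have inZ: "a \<in> Z" "a' \<in> Z" "b \<in> Z" "b' \<in> Z"
      using AZ[OF i] a AZ[OF i'] a' BZ[OF j] b BZ[OF j'] b' by auto
    have xM: "x \<in> M" "x' \<in> M" and yN: "y \<in> N" "y' \<in> N"
      using inZ c c' d d' CM[OF i] CM[OF i'] DN[OF j] DN[OF j']
        subgroup.m_closed[OF M] subgroup.m_closed[OF N]
      unfolding xac xac' ybd ybd' ZMN by blast+
    have mem: "x \<in> carrier G" "x' \<in> carrier G" "y \<in> carrier G" "y' \<in> carrier G"
      "a \<in> carrier G" "a' \<in> carrier G" "b \<in> carrier G" "b' \<in> carrier G"
      using xM yN inZ ZG subgroup.subset[OF M] subgroup.subset[OF N] by blast+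
    \<comment> \<open>The equation also gives \<open>z = y' \<otimes> inv y\<close>, so
      \<open>z\<close> lies in \<open>M\<close> and in \<open>N\<close>. Only then is it known to be
      central, which allows \<open>x' \<otimes> z\<close> to be turned into
      \<open>z \<otimes> x'\<close>.\<close>
    define z where "z = inv x' \<otimes> x"
    have zG: "z \<in> carrier G" using mem unfolding z_def by simp
    have xz': "x = x' \<otimes> z" using mem unfolding z_def by (simp add: m_assoc[symmetric])
    have "x' \<otimes> (z \<otimes> y) = x' \<otimes> y'" using eq xz' mem zG by (simp add: m_assoc)
    then have yz: "y' = z \<otimes> y" using mem zG by simp
    then have "z = y' \<otimes> inv y" using mem zG by (simp add: m_assoc)
    then have zZ: "z \<in> Z"
      using xM yN M N unfolding ZMN
      by (metis IntI z_def subgroup.m_closed subgroup.m_inv_closed)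
    have xz: "x = z \<otimes> x'" using xz' central_product_central[OF cp zZ mem(2)] by simp
    note 1 = class_factor_translate[OF cp i[unfolded I] C[OF i] i'[unfolded I] C[OF i']
        c c' inZ(1,2) zZ xz[unfolded xac xac']]
    \<comment> \<open>Primed and unprimed data are exchanged here: \<open>z\<close> multiplies
      \<open>x'\<close> on the side of \<open>M\<close>, but \<open>y\<close> on the side of
      \<open>N\<close>.\<close>
    note 2 = class_factor_translate[OF cp' j'[unfolded J] D[OF j'] j[unfolded J] D[OF j]
        d' d inZ(4,3) zZ yz[unfolded ybd ybd']]
    have ii: "i = i'" and jj: "j' = j" using 1(1) 2(1) by auto
    have za: "z \<otimes> a' \<in> A i" using 1(2)[OF _ kA[OF i j] a] ii by simp
    have zb: "z \<otimes> b \<in> B j" using 2(2)[OF _ kB[OF i j', folded jj] b'] jj by simp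
    have "(z \<otimes> a') \<otimes> b = a' \<otimes> (z \<otimes> b)"
      using central_product_central[OF cp zZ mem(6)] mem zG by (simp add: m_assoc[symmetric])
    then have "z \<otimes> a' = a'" using uniq[OF i j za _ b zb] a' ii by simp
    then have "z = \<one>" using mem zG by simp
    then show ?thesis using xz yz mem by simp
  qed
  have "?X \<noteq> {}" "?Y \<noteq> {}"
  proof -
    \<comment> \<open>Existence of orbits keeps the unions from being empty; directness of the
      product of \<open>A i\<close> and \<open>B j\<close> makes these coefficient sets
      nonempty.\<close>
    obtain i j where ij: "i \<in> I" "j \<in> J" using ne by auto
    have "A i \<noteq> {}" "B j \<noteq> {}"
      using dec[OF ij] unfolding set_direct_decomposition_def set_direct_def by auto
    then show "?X \<noteq> {}" "?Y \<noteq> {}"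
      using ij CM(2)[OF ij(1)] DN(2)[OF ij(2)] unfolding set_mult_def by blast+
  qed
  moreover have "\<exists>!p. p \<in> ?X \<times> ?Y \<and> g = fst p \<otimes> snd p" if g: "g \<in> ?X <#> ?Y" for g
  proof -
    obtain x y where xy: "x \<in> ?X" "y \<in> ?Y" "g = x \<otimes> y"
      using g unfolding set_mult_def by blast
    show ?thesis
    proof (rule ex1I[of _ "(x, y)"])
      show "(x, y) \<in> ?X \<times> ?Y \<and> g = fst (x, y) \<otimes> snd (x, y)" using xy by simp
      fix p assume p: "p \<in> ?X \<times> ?Y \<and> g = fst p \<otimes> snd p"
      then have "fst p \<in> ?X" "snd p \<in> ?Y" by (metis mem_Times_iff)+
      then show "p = (x, y)" using inj[OF _ xy(1) _ xy(2)] p xy(3) by (metis prod.collapse)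
    qed
  qed
  ultimately show ?thesis
    unfolding set_direct_decomposition_def set_direct_def
    using nX nY subset_antisym[OF cover XY] by (intro conjI ballI) simp_all
qed

end
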